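(* Let $X$ be a finite universe and $C$ a concept class of predicates $X\to\{0,1\}$. Let $\alpha,\beta,\gamma,\tau>0$ with $\tau\le\beta/8$, and let $\mathcal{A}$ be an $(\alpha/2,\beta,\gamma,\tau)$-weak agnostic SQ-learner for $C$. Then there exists an algorithm $\mathcal{B}$ that, given statistical-query access to a distribution $D$ over $X$, invokes $\mathcal{A}$ at most $T=8\log|X|/\beta^2$ times and, with probability at least $1-T\gamma$, $(\alpha,0)$-releases $C$, i.e. outputs values $a_c$ for all $c\in C$ with $|a_c-\mathbb{E}_{x\sim D}c(x)|\le\alpha$ for every $c\in C$.
   Context: For a distribution $A$ (over $X$ or over $X\times\{0,1\}$), the statistical query oracle $\mathrm{STAT}_\tau(A)$ takes a predicate $q$ and returns a value $v$ with $|v-\mathbb{E}_{A}[q]|\le\tau$. For $0<\beta<\alpha\le1/2$ and $\gamma,\tau>0$, an algorithm $\mathcal{A}$ with oracle access to $\mathrm{STAT}_\tau(A)$ is an $(\alpha,\beta,\gamma,\tau)$-weak agnostic learner for $C$ if for every distribution $A$ over $X\times\{0,1\}$ such that some $q^*\in C$ satisfies $\Pr_{(x,b)\sim A}\{q^*(x)=b\}\ge\frac12+\alpha$, $\mathcal{A}$ outputs with probability at least $1-\gamma$ a predicate $q\colon X\to\{0,1\}$ with $\Pr_{(x,b)\sim A}\{q(x)=b\}\ge\frac12+\beta$. *)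

theory Defs
  imports "HOL-Probability.Probability"
begin

text \<open>
  Randomised statistical-query algorithms as decision trees: a node returns a value, submits a
  query and continues with the real number received, or draws its continuation from a discrete
  distribution. Every path in a datatype value is finite, so the algorithms always halt; no
  uniform bound on the number of queries is imposed.
\<close>

datatype ('q, 'r) sq_alg =
    Return 'r
  | Query 'q "real \<Rightarrow> ('q, 'r) sq_alg"
  | Sample "('q, 'r) sq_alg pmf"

text \<open>
  Oracles may answer adaptively: a reply depends on the list of queries submitted so far, so
  repeated queries need not get equal replies. They do not see the algorithm's coins.
\<close>

type_synonym 'q answerer = "'q list \<Rightarrow> 'q \<Rightarrow> real"

primrec run :: "'q answerer \<Rightarrow> ('q, 'r) sq_alg \<Rightarrow> 'q list \<Rightarrow> 'r pmf" where
  "run orc (Return z) h = return_pmf z"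
| "run orc (Query q k) h = run orc (k (orc h q)) (h @ [q])"
| "run orc (Sample p) h = bind_pmf (map_pmf (run orc) p) (\<lambda>f. f h)"

definition stat_oracle :: "real \<Rightarrow> 'b pmf \<Rightarrow> ('b \<Rightarrow> bool) answerer \<Rightarrow> bool" where
  "stat_oracle \<tau> P orc \<longleftrightarrow>
     (\<forall>h q. \<bar>orc h q - measure_pmf.expectation P (\<lambda>z. of_bool (q z))\<bar> \<le> \<tau>)"

definition agreement :: "('a \<times> bool) pmf \<Rightarrow> ('a \<Rightarrow> bool) \<Rightarrow> real" where
  "agreement P q = measure_pmf.prob P {(x, b). q x = b}"

type_synonym 'a learner = "('a \<times> bool \<Rightarrow> bool, 'a \<Rightarrow> bool) sq_alg"

definition weak_agnostic_learner ::
  "real \<Rightarrow> real \<Rightarrow> real \<Rightarrow> real \<Rightarrow> ('a \<Rightarrow> bool) set \<Rightarrow> 'a learner \<Rightarrow> bool" where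
  "weak_agnostic_learner \<alpha> \<beta> \<gamma> \<tau> C A \<longleftrightarrow>
     0 < \<beta> \<and> \<beta> < \<alpha> \<and> \<alpha> \<le> 1 / 2 \<and> 0 < \<gamma> \<and> 0 < \<tau> \<and>
     (\<forall>P orc. (\<exists>q\<in>C. agreement P q \<ge> 1 / 2 + \<alpha>) \<and> stat_oracle \<tau> P orc \<longrightarrow>
        measure_pmf.prob (run orc A []) {q. agreement P q \<ge> 1 / 2 + \<beta>} \<ge> 1 - \<gamma>)"

text \<open>
  An algorithm that has statistical-query access to a distribution on \<^typ>\<open>'a\<close> and may invoke a
  learner. Invoking it means running it from scratch, each of its queries being answered by a
  statistical-query computation over \<^typ>\<open>'a\<close> (the first argument of Invoke); the algorithm then
  continues with the hypothesis obtained. The learner is a black box, supplied by link below.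
\<close>

datatype ('a, 'r) invoking_alg =
    Output 'r
  | Ask "'a \<Rightarrow> bool" "real \<Rightarrow> ('a, 'r) invoking_alg"
  | Toss "('a, 'r) invoking_alg pmf"
  | Invoke "('a \<times> bool \<Rightarrow> bool) \<Rightarrow> ('a \<Rightarrow> bool, real) sq_alg"
      "('a \<Rightarrow> bool) \<Rightarrow> ('a, 'r) invoking_alg"

primrec sq_bind :: "('q, 'r) sq_alg \<Rightarrow> ('r \<Rightarrow> ('q, 's) sq_alg) \<Rightarrow> ('q, 's) sq_alg" where
  "sq_bind (Return z) f = f z"
| "sq_bind (Query q k) f = Query q (\<lambda>v. sq_bind (k v) f)"
| "sq_bind (Sample p) f = Sample (map_pmf (\<lambda>g. g f) (map_pmf sq_bind p))"

primrec simulate :: "('p \<Rightarrow> ('q, real) sq_alg) \<Rightarrow> ('p, 'r) sq_alg \<Rightarrow> ('q, 'r) sq_alg" where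
  "simulate s (Return z) = Return z"
| "simulate s (Query p k) = sq_bind (s p) (\<lambda>v. simulate s (k v))"
| "simulate s (Sample p) = Sample (map_pmf (simulate s) p)"

primrec link :: "'a learner \<Rightarrow> ('a, 'r) invoking_alg \<Rightarrow> ('a \<Rightarrow> bool, 'r) sq_alg" where
  "link A (Output z) = Return z"
| "link A (Ask q k) = Query q (\<lambda>v. link A (k v))"
| "link A (Toss p) = Sample (map_pmf (link A) p)"
| "link A (Invoke s k) = sq_bind (simulate s A) (\<lambda>q. link A (k q))"

text \<open>
  The pairs (number of invocations, number of queries submitted outside invocations) that occur
  along some execution path, for arbitrary replies and arbitrary learner outputs. The second
  component matters because \<^term>\<open>\<tau>::real\<close> is smaller than the release accuracy \<^term>\<open>\<alpha>::real\<close>: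
  with unrestricted queries of its own an algorithm could ask for every concept directly, and
  a bound on the invocations alone would say nothing.
\<close>

primrec usage :: "('a, 'r) invoking_alg \<Rightarrow> (nat \<times> nat) set" where
  "usage (Output z) = {(0, 0)}"
| "usage (Ask q k) = (\<Union>v. apsnd Suc ` usage (k v))"
| "usage (Toss p) = \<Union> (set_pmf (map_pmf usage p))"
| "usage (Invoke s k) = (\<Union>q. apfst Suc ` usage (k q))"

definition releases ::
  "real \<Rightarrow> 'a pmf \<Rightarrow> ('a \<Rightarrow> bool) set \<Rightarrow> (('a \<Rightarrow> bool) \<Rightarrow> real) \<Rightarrow> bool" where
  "releases \<alpha> D C a \<longleftrightarrow>
     (\<forall>c\<in>C. \<bar>a c - measure_pmf.expectation D (\<lambda>x. of_bool (c x))\<bar> \<le> \<alpha>)"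

end

theory Submission
  imports Defs
begin

text \<open>
  Multiplicative weights. The algorithm keeps a hypothesis \<open>Q\<close>, initially uniform, whose
  probabilities are proportional to \<open>exp \<circ> f\<close>. If \<open>C\<close> separates \<open>D\<close> from \<open>Q\<close> by more than \<open>\<alpha>\<close>,
  then for one of the two signs \<open>s\<close> the mixture that draws from \<open>D\<close> with label \<open>s\<close> and from \<open>Q\<close>
  with label \<open>\<not> s\<close>, each with probability 1/2, satisfies the promise of the learner. A hypothesis
  of agreement at least \<open>1/2 + \<beta>\<close> on this mixture distinguishes \<open>D\<close> from \<open>Q\<close> with advantage
  \<open>2 * \<beta>\<close>; after a single query of verification it is used to reweight \<open>Q\<close>. The cross entropy of
  \<open>D\<close> and \<open>Q\<close> starts at \<open>ln |X|\<close>, stays nonnegative, and drops by at least \<open>3/4 * \<beta>\<^sup>2\<close> with each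
  update, so there are at most \<open>4/3 * ln |X| / \<beta>\<^sup>2\<close> updates, and every round costs at most two
  invocations.
\<close>

section \<open>Composition of statistical-query algorithms\<close>

text \<open>
  Since oracle replies depend on past queries, a sequential composition can only be analysed
  together with the query history that its first part leaves behind.
\<close>

primrec run_hist :: "'q answerer \<Rightarrow> ('q, 'r) sq_alg \<Rightarrow> 'q list \<Rightarrow> ('r \<times> 'q list) pmf" where
  "run_hist orc (Return z) h = return_pmf (z, h)"
| "run_hist orc (Query q k) h = run_hist orc (k (orc h q)) (h @ [q])"
| "run_hist orc (Sample p) h = bind_pmf (map_pmf (run_hist orc) p) (\<lambda>f. f h)"

lemma run_sq_bind:
  "run orc (sq_bind g f) h = bind_pmf (run_hist orc g h) (\<lambda>(z, h'). run orc (f z) h')"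
proof (induction g arbitrary: h)
  case (Sample p)
  then show ?case
    by (auto simp: bind_map_pmf bind_assoc_pmf map_pmf_comp intro!: bind_pmf_cong)
qed (auto simp: bind_return_pmf)

text \<open>Each learner query costs exactly one outer query, so the outer history is always
  \<open>h @ map u l\<close> with \<open>l\<close> the learner's own history. For fixed
  \<open>h\<close> the simulated replies thus depend on \<open>l\<close> and the current query only,
  and form an adaptive answerer of the kind the learner's guarantee speaks about.\<close>

lemma map_fst_run_hist_simulate:
  fixes u :: "'p \<Rightarrow> 'q" and c :: "'p \<Rightarrow> real \<Rightarrow> real"
  defines "s \<equiv> \<lambda>p. Query (u p) (\<lambda>v. Return (c p v))"
  shows "map_pmf fst (run_hist orc (simulate s A) (h @ map u h')) =
           run (\<lambda>l p. c p (orc (h @ map u l) (u p))) A h'"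
proof (induction A arbitrary: h')
  case (Query p k)
  then show ?case
    using Query.IH[OF rangeI, of _ "h' @ [p]"] by (simp add: s_def)
next
  case (Sample p)
  then show ?case
    by (auto simp: map_bind_pmf bind_map_pmf intro!: bind_pmf_cong)
qed simp

lemma prob_bind_pmf_le:
  assumes "measure_pmf.prob p S \<le> \<gamma>" and "\<delta> \<ge> 0"
    and "\<And>x. x \<in> set_pmf p \<Longrightarrow> x \<notin> S \<Longrightarrow> measure_pmf.prob (f x) G \<le> \<delta>"
  shows "measure_pmf.prob (bind_pmf p f) G \<le> \<gamma> + \<delta>"
proof -
  have "emeasure (bind_pmf p f) G = (\<integral>\<^sup>+x. emeasure (f x) G \<partial>p)"
    by simp
  also have "\<dots> \<le> (\<integral>\<^sup>+x. indicator S x + ennreal \<delta> \<partial>p)"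
  proof (intro nn_integral_mono_AE, unfold AE_measure_pmf_iff, intro ballI)
    fix x assume x: "x \<in> set_pmf p"
    show "emeasure (f x) G \<le> indicator S x + ennreal \<delta>"
    proof (cases "x \<in> S")
      case True
      have "emeasure (f x) G \<le> 1"
        by (rule measure_pmf.emeasure_le_1)
      also have "\<dots> \<le> indicator S x + ennreal \<delta>"
        using True by simp
      finally show ?thesis .
    next
      case False
      then show ?thesis
        using assms(3)[OF x] by (simp add: measure_pmf.emeasure_eq_measure ennreal_leI)
    qed
  qed
  also have "\<dots> = ennreal (measure_pmf.prob p S + \<delta>)"
    using assms(2) by (simp add: nn_integral_add measure_pmf.emeasure_eq_measure)
  also have "\<dots> \<le> ennreal (\<gamma> + \<delta>)"
    using assms(1) by (intro ennreal_leI) simp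
  finally show ?thesis
    using assms(2) order_trans[OF measure_nonneg assms(1)]
    by (simp add: measure_pmf.emeasure_eq_measure del: ennreal_plus)
qed

section \<open>The labelled mixture\<close>

abbreviation query_mean :: "'a pmf \<Rightarrow> ('a \<Rightarrow> bool) \<Rightarrow> real" where
  "query_mean D q \<equiv> measure_pmf.expectation D (\<lambda>x. of_bool (q x))"

lemma query_mean_eq_prob: "query_mean D q = measure_pmf.prob D {x. q x}"
proof -
  have "query_mean D q = measure_pmf.expectation D (indicator {x. q x})"
    by (intro Bochner_Integration.integral_cong) (auto simp: indicator_def)
  then show ?thesis by simp
qed

lemma query_mean_not: "query_mean D (\<lambda>x. \<not> q x) = 1 - query_mean D q"
proof -
  have "{x. \<not> q x} = UNIV - {x. q x}" by auto
  then show ?thesis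
    using measure_pmf.prob_compl[of "{x. q x}" D] by (simp add: query_mean_eq_prob)
qed

definition mixture :: "bool \<Rightarrow> 'a pmf \<Rightarrow> 'a pmf \<Rightarrow> ('a \<times> bool) pmf" where
  "mixture s D Q =
     bind_pmf (bernoulli_pmf (1 / 2)) (\<lambda>b. map_pmf (\<lambda>x. (x, b = s)) (if b then D else Q))"

lemma query_mean_mixture:
  fixes D Q :: "'a::finite pmf"
  shows "query_mean (mixture s D Q) p =
           (query_mean D (\<lambda>x. p (x, s)) + query_mean Q (\<lambda>x. p (x, \<not> s))) / 2"
  unfolding mixture_def
  by (subst pmf_expectation_bind[of UNIV]) (auto simp: UNIV_bool)

text \<open>On the \<open>Q\<close> half the label is \<open>\<not> s\<close>, so agreement there is
  the complement of \<open>q x = s\<close>. For \<open>s = False\<close> the predicate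
  \<open>q x = s\<close> is the negation of \<open>q\<close>, which is how the sign of the gap
  enters.\<close>

lemma agreement_mixture:
  fixes D Q :: "'a::finite pmf"
  shows "agreement (mixture s D Q) q =
           1 / 2 + (query_mean D (\<lambda>x. q x = s) - query_mean Q (\<lambda>x. q x = s)) / 2"
proof -
  have "agreement (mixture s D Q) q = query_mean (mixture s D Q) (\<lambda>(x, b). q x = b)"
    by (simp add: agreement_def query_mean_eq_prob case_prod_unfold)
  also have "\<dots> = (query_mean D (\<lambda>x. q x = s) + query_mean Q (\<lambda>x. \<not> (q x = s))) / 2"
    by (simp add: query_mean_mixture)
  also have "\<dots> = 1 / 2 + (query_mean D (\<lambda>x. q x = s) - query_mean Q (\<lambda>x. q x = s)) / 2"
    by (subst query_mean_not) (simp add: field_simps)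
  finally show ?thesis .
qed

section \<open>Gibbs distributions\<close>

definition gibbs :: "('a::finite \<Rightarrow> real) \<Rightarrow> 'a pmf" where
  "gibbs f = embed_pmf (\<lambda>x. exp (f x) / (\<Sum>y\<in>UNIV. exp (f y)))"

lemma sum_exp_pos: "(\<Sum>y\<in>UNIV. exp (f y)) > (0::real)" for f :: "'a::finite \<Rightarrow> real"
  by (intro sum_pos) auto

lemma pmf_gibbs: "pmf (gibbs f) x = exp (f x) / (\<Sum>y\<in>UNIV. exp (f y))"
  unfolding gibbs_def
proof (rule pmf_embed_pmf)
  show "0 \<le> exp (f x) / (\<Sum>y\<in>UNIV. exp (f y))" for x
    using sum_exp_pos[of f] by simp
  have "(\<Sum>x\<in>UNIV. exp (f x) / (\<Sum>y\<in>UNIV. exp (f y))) = 1"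
    using sum_exp_pos[of f] by (simp flip: sum_divide_distrib)
  then show "(\<integral>\<^sup>+ x. ennreal (exp (f x) / (\<Sum>y\<in>UNIV. exp (f y))) \<partial>count_space UNIV) = 1"
    using sum_exp_pos[of f]
    by (simp add: nn_integral_count_space_finite sum_ennreal less_imp_le)
qed

text \<open>The mean under \<open>D\<close> of \<open>- ln (pmf (gibbs f) x)\<close>. It exceeds the
  relative entropy of \<open>D\<close> to \<open>gibbs f\<close> by the entropy of \<open>D\<close>,
  which no update changes.\<close>

definition cross_entropy :: "'a::finite pmf \<Rightarrow> ('a \<Rightarrow> real) \<Rightarrow> real" where
  "cross_entropy D f = ln (\<Sum>x\<in>UNIV. exp (f x)) - measure_pmf.expectation D f"

lemma expectation_finite_type:
  "measure_pmf.expectation D g = (\<Sum>x\<in>UNIV. g x * pmf D x)" for D :: "'a::finite pmf"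
  and g :: "'a \<Rightarrow> real"
  by (rule integral_measure_pmf_real) auto

lemma cross_entropy_nonneg: "cross_entropy D f \<ge> 0"
proof -
  have "f x \<le> ln (\<Sum>x\<in>UNIV. exp (f x))" for x
    using sum_exp_pos[of f] member_le_sum[of x UNIV "\<lambda>x. exp (f x)"] by (simp add: ln_ge_iff)
  then have "measure_pmf.expectation D f \<le> measure_pmf.expectation D (\<lambda>_. ln (\<Sum>x\<in>UNIV. exp (f x)))"
    by (intro integral_mono) (auto intro: integrable_measure_pmf_finite)
  then show ?thesis
    by (simp add: cross_entropy_def)
qed

lemma cross_entropy_update:
  fixes D :: "'a::finite pmf"
  assumes "0 \<le> \<eta>" "\<eta> \<le> 1"
  shows "cross_entropy D (\<lambda>x. f x + \<eta> * of_bool (q x)) \<le>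
           cross_entropy D f - \<eta> * (query_mean D q - query_mean (gibbs f) q) + \<eta>\<^sup>2"
proof -
  define W where "W = (\<Sum>x\<in>UNIV. exp (f x))"
  define m where "m = query_mean (gibbs f) q"
  have W: "W > 0"
    unfolding W_def by (rule sum_exp_pos)
  have Wm: "(\<Sum>x\<in>UNIV. exp (f x) * of_bool (q x)) = W * m"
    using W unfolding m_def expectation_finite_type pmf_gibbs W_def[symmetric]
    by (simp add: sum_distrib_left mult.commute)
  have m: "0 \<le> m" "m \<le> 1"
    by (simp_all add: m_def query_mean_eq_prob)
  have pos: "0 < 1 + \<eta> * m + \<eta>\<^sup>2"
    using assms m by (intro add_pos_nonneg) auto
  \<comment> \<open>The added exponent is 0 or \<open>\<eta>\<close>, so
    \<open>exp \<eta> \<le> 1 + \<eta> + \<eta>\<^sup>2\<close> gives a bound linear in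
    \<open>of_bool (q x)\<close>, which sums to a mean.\<close>
  have "exp (f x + \<eta> * of_bool (q x)) \<le> exp (f x) * (1 + (\<eta> + \<eta>\<^sup>2) * of_bool (q x))" for x
    using exp_bound[OF assms] by (simp add: exp_add of_bool_def)
  then have "(\<Sum>x\<in>UNIV. exp (f x + \<eta> * of_bool (q x))) \<le>
      (\<Sum>x\<in>UNIV. exp (f x) * (1 + (\<eta> + \<eta>\<^sup>2) * of_bool (q x)))"
    by (intro sum_mono)
  also have "\<dots> = W + (\<eta> + \<eta>\<^sup>2) * (\<Sum>x\<in>UNIV. exp (f x) * of_bool (q x))"
    unfolding W_def sum_distrib_left sum.distrib[symmetric]
    by (intro sum.cong) (auto simp: algebra_simps)
  also have "\<dots> = W * (1 + \<eta> * m + \<eta>\<^sup>2 * m)"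
    unfolding Wm by (simp add: algebra_simps)
  also have "\<dots> \<le> W * (1 + \<eta> * m + \<eta>\<^sup>2)"
    using W m by (intro mult_left_mono add_left_mono) (auto simp: mult_left_le)
  finally have "ln (\<Sum>x\<in>UNIV. exp (f x + \<eta> * of_bool (q x))) \<le> ln (W * (1 + \<eta> * m + \<eta>\<^sup>2))"
    using sum_exp_pos[of "\<lambda>x. f x + \<eta> * of_bool (q x)"] by (intro ln_mono) auto
  also have "\<dots> = ln W + ln (1 + (\<eta> * m + \<eta>\<^sup>2))"
    using W pos by (simp add: ln_mult add.assoc)
  also have "\<dots> \<le> ln W + (\<eta> * m + \<eta>\<^sup>2)"
    using pos by (intro add_left_mono ln_add_one_self_le_self2) auto
  finally have "ln (\<Sum>x\<in>UNIV. exp (f x + \<eta> * of_bool (q x))) \<le> ln W + (\<eta> * m + \<eta>\<^sup>2)" .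
  moreover have "measure_pmf.expectation D (\<lambda>x. f x + \<eta> * of_bool (q x)) =
      measure_pmf.expectation D f + \<eta> * query_mean D q"
    by (subst Bochner_Integration.integral_add) (auto intro: integrable_measure_pmf_finite)
  ultimately show ?thesis
    by (simp add: cross_entropy_def W_def m_def algebra_simps)
qed

section \<open>The release algorithm\<close>

text \<open>\<open>Q\<close> is known explicitly, so only the \<open>D\<close> half needs a query;
  the averaging halves the oracle error.\<close>

definition answer_mixture ::
  "bool \<Rightarrow> 'a pmf \<Rightarrow> ('a \<times> bool \<Rightarrow> bool) \<Rightarrow> ('a \<Rightarrow> bool, real) sq_alg" where
  "answer_mixture s Q p = Query (\<lambda>x. p (x, s))
     (\<lambda>v. Return ((v + query_mean Q (\<lambda>x. p (x, \<not> s))) / 2))"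

text \<open>Passing on \<open>q x = s\<close> instead of \<open>q\<close> makes every accepted
  predicate one that \<open>D\<close> favours over \<open>Q\<close>, so updates only ever add
  weight.\<close>

definition attempt ::
  "real \<Rightarrow> 'a pmf \<Rightarrow> bool \<Rightarrow> (('a \<Rightarrow> bool) \<Rightarrow> ('a, 'r) invoking_alg) \<Rightarrow> ('a, 'r) invoking_alg \<Rightarrow>
     ('a, 'r) invoking_alg" where
  "attempt \<theta> Q s succ fl = Invoke (answer_mixture s Q) (\<lambda>q. Ask (\<lambda>x. q x = s) (\<lambda>v.
     if v - query_mean Q (\<lambda>x. q x = s) \<ge> \<theta> then succ (\<lambda>x. q x = s) else fl))"

text \<open>The natural number is a budget of updates. The output at budget 0 is a default, never
  reached under accurate replies if the budget covers the initial cross entropy.\<close>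

primrec release ::
  "real \<Rightarrow> real \<Rightarrow> nat \<Rightarrow> ('a::finite \<Rightarrow> real) \<Rightarrow> ('a, ('a \<Rightarrow> bool) \<Rightarrow> real) invoking_alg" where
  "release \<theta> \<eta> 0 f = Output (query_mean (gibbs f))"
| "release \<theta> \<eta> (Suc m) f =
     (let next_round = (\<lambda>q. release \<theta> \<eta> m (\<lambda>x. f x + \<eta> * of_bool (q x)))
      in attempt \<theta> (gibbs f) True next_round
           (attempt \<theta> (gibbs f) False next_round (Output (query_mean (gibbs f)))))"

section \<open>Counting invocations and own queries\<close>

lemma usage_attempt:
  assumes "\<And>q i j. (i, j) \<in> usage (succ q) \<Longrightarrow> i \<le> n \<and> j \<le> i"
    and "\<And>i j. (i, j) \<in> usage fl \<Longrightarrow> i \<le> n \<and> j \<le> i"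
    and "(i, j) \<in> usage (attempt \<theta> Q s succ fl)"
  shows "i \<le> Suc n \<and> j \<le> i"
  using assms by (fastforce simp: attempt_def split: if_splits)

lemma usage_release: "(i, j) \<in> usage (release \<theta> \<eta> m f) \<Longrightarrow> i \<le> 2 * m \<and> j \<le> i"
proof (induction m arbitrary: f i j)
  case (Suc m)
  define next_round where "next_round = (\<lambda>q. release \<theta> \<eta> m (\<lambda>x. f x + \<eta> * of_bool (q x)))"
  define second where
    "second = attempt \<theta> (gibbs f) False next_round (Output (query_mean (gibbs f)))"
  have next_round: "i \<le> 2 * m \<and> j \<le> i" if "(i, j) \<in> usage (next_round q)" for q i j
    using Suc.IH that unfolding next_round_def .
  have second: "i \<le> Suc (2 * m) \<and> j \<le> i" if "(i, j) \<in> usage second" for i j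
    using that unfolding second_def by (rule usage_attempt[rotated 2]) (auto dest: next_round)
  have "(i, j) \<in> usage (attempt \<theta> (gibbs f) True next_round second)"
    using Suc.prems by (simp add: Let_def next_round_def second_def)
  then have "i \<le> Suc (Suc (2 * m)) \<and> j \<le> i"
    by (rule usage_attempt[rotated 2]) (auto dest: next_round second simp: le_Suc_eq)
  then show ?case by simp
qed simp

section \<open>Failure probability for a fixed distribution and oracle\<close>

context
  fixes C :: "('a::finite \<Rightarrow> bool) set" and A :: "'a learner" and \<alpha> \<beta> \<gamma> \<tau> :: real
    and D :: "'a pmf" and orc :: "('a \<Rightarrow> bool) answerer"
  assumes learner: "weak_agnostic_learner (\<alpha> / 2) \<beta> \<gamma> \<tau> C A"
    and accuracy: "\<tau> \<le> \<beta> / 8"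
    and answers: "stat_oracle \<tau> D orc"
begin

lemma parameters: "0 < \<beta>" "2 * \<beta> < \<alpha>" "\<alpha> \<le> 1" "0 < \<gamma>" "0 < \<tau>"
  using learner by (auto simp: weak_agnostic_learner_def)

text \<open>A gap of \<open>\<alpha>\<close> is an agreement of \<open>1 / 2 + \<alpha> / 2\<close>
  on the mixture, which is the learner's promise, and an agreement of \<open>1 / 2 + \<beta>\<close>
  is a gap of \<open>2 * \<beta>\<close>. The history \<open>h\<close> is arbitrary because earlier
  rounds leave queries behind.\<close>

lemma prob_learner_fails:
  assumes "\<exists>c\<in>C. query_mean D (\<lambda>x. c x = s) - query_mean Q (\<lambda>x. c x = s) \<ge> \<alpha>"
  shows "measure_pmf.prob (run_hist orc (simulate (answer_mixture s Q) A) h)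
    {(q, h'). query_mean D (\<lambda>x. q x = s) - query_mean Q (\<lambda>x. q x = s) < 2 * \<beta>} \<le> \<gamma>"
    (is "measure_pmf.prob ?R ?bad \<le> \<gamma>")
proof -
  define P where "P = mixture s D Q"
  define u :: "('a \<times> bool \<Rightarrow> bool) \<Rightarrow> 'a \<Rightarrow> bool" where "u = (\<lambda>p x. p (x, s))"
  define c where "c = (\<lambda>p v. (v + query_mean Q (\<lambda>x. p (x, \<not> s))) / 2)"
  define orc' where "orc' = (\<lambda>l p. c p (orc (h @ map u l) (u p)))"
  have "map_pmf fst (run_hist orc (simulate (\<lambda>p. Query (u p) (\<lambda>v. Return (c p v))) A) (h @ map u [])) =
      run orc' A []"
    unfolding orc'_def by (rule map_fst_run_hist_simulate)
  moreover have "(\<lambda>p. Query (u p) (\<lambda>v. Return (c p v))) = answer_mixture s Q"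
    by (simp add: fun_eq_iff answer_mixture_def u_def c_def)
  ultimately have run: "map_pmf fst ?R = run orc' A []"
    by simp
  have "stat_oracle \<tau> P orc'"
    unfolding stat_oracle_def
  proof (intro allI)
    fix l p
    have "\<bar>orc (h @ map u l) (u p) - query_mean D (u p)\<bar> \<le> \<tau>"
      using answers by (simp add: stat_oracle_def)
    moreover have "query_mean P p = (query_mean D (u p) + query_mean Q (\<lambda>x. p (x, \<not> s))) / 2"
      by (simp add: P_def query_mean_mixture u_def)
    ultimately show "\<bar>orc' l p - query_mean P p\<bar> \<le> \<tau>"
      using parameters(5) by (simp add: orc'_def c_def abs_le_iff field_simps)
  qed
  moreover have "\<exists>q\<in>C. agreement P q \<ge> 1 / 2 + \<alpha> / 2"
    using assms by (auto simp: P_def agreement_mixture)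
  ultimately have "1 - \<gamma> \<le> measure_pmf.prob (run orc' A []) {q. agreement P q \<ge> 1 / 2 + \<beta>}"
    using learner by (simp add: weak_agnostic_learner_def)
  also have "\<dots> = measure_pmf.prob ?R (fst -` {q. agreement P q \<ge> 1 / 2 + \<beta>})"
    by (simp flip: run)
  also have "fst -` {q. agreement P q \<ge> 1 / 2 + \<beta>} = UNIV - ?bad"
    by (auto simp: P_def agreement_mixture)
  also have "measure_pmf.prob ?R (UNIV - ?bad) = 1 - measure_pmf.prob ?R ?bad"
    using measure_pmf.prob_compl[of ?bad ?R] by simp
  finally show ?thesis by simp
qed

text \<open>With threshold \<open>2 * \<beta> - \<tau>\<close>, a gap of \<open>2 * \<beta>\<close>
  always passes the check, and whatever passes has gap at least
  \<open>2 * \<beta> - 2 * \<tau>\<close>. Only the learner can go wrong, at cost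
  \<open>\<gamma>\<close>.\<close>

lemma prob_attempt_fails:
  assumes succ: "\<And>q h. query_mean D q - query_mean Q q \<ge> 2 * \<beta> - 2 * \<tau> \<Longrightarrow>
      measure_pmf.prob (run orc (link A (succ q)) h) G \<le> \<delta>"
    and fl: "\<And>h. \<forall>c\<in>C. query_mean D (\<lambda>x. c x = s) - query_mean Q (\<lambda>x. c x = s) < \<alpha> \<Longrightarrow>
      measure_pmf.prob (run orc (link A fl) h) G \<le> \<delta>"
    and "\<delta> \<ge> 0"
  shows "measure_pmf.prob (run orc (link A (attempt (2 * \<beta> - \<tau>) Q s succ fl)) h) G \<le> \<gamma> + \<delta>"
proof -
  define gap where "gap = (\<lambda>q. query_mean D (\<lambda>x. q x = s) - query_mean Q (\<lambda>x. q x = s))"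
  define R where "R = run_hist orc (simulate (answer_mixture s Q) A) h"
  \<comment> \<open>A bad hypothesis counts as failure only if the promise holds; otherwise both
    outcomes of the check lead to a legitimate continuation.\<close>
  define S where "S = {(q, h' :: ('a \<Rightarrow> bool) list). (\<exists>c\<in>C. gap c \<ge> \<alpha>) \<and> gap q < 2 * \<beta>}"
  have S: "measure_pmf.prob R S \<le> \<gamma>"
  proof (cases "\<exists>c\<in>C. gap c \<ge> \<alpha>")
    case True
    then show ?thesis
      using prob_learner_fails[of s Q h] by (simp add: R_def S_def gap_def)
  next
    case False
    then have "S = {}" by (auto simp: S_def)
    then show ?thesis using parameters(4) by simp
  qed
  show ?thesis
    unfolding attempt_def link.simps run_sq_bind R_def[symmetric]
  proof (rule prob_bind_pmf_le[OF S \<open>\<delta> \<ge> 0\<close>])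
    fix y assume "y \<notin> S"
    obtain q h' where y: "y = (q, h')" by force
    define v where "v = orc h' (\<lambda>x. q x = s)"
    have v: "\<bar>v - query_mean D (\<lambda>x. q x = s)\<bar> \<le> \<tau>"
      using answers by (simp add: stat_oracle_def v_def)
    have "measure_pmf.prob (run orc (link A
        (if v - query_mean Q (\<lambda>x. q x = s) \<ge> 2 * \<beta> - \<tau> then succ (\<lambda>x. q x = s) else fl))
        (h' @ [\<lambda>x. q x = s])) G \<le> \<delta>"
    proof (cases "v - query_mean Q (\<lambda>x. q x = s) \<ge> 2 * \<beta> - \<tau>")
      case True
      then have "query_mean D (\<lambda>x. q x = s) - query_mean Q (\<lambda>x. q x = s) \<ge> 2 * \<beta> - 2 * \<tau>"
        using v by linarith
      with True show ?thesis by (simp add: succ)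
    next
      case False
      then have "gap q < 2 * \<beta>"
        using v unfolding gap_def by linarith
      then have "\<forall>c\<in>C. gap c < \<alpha>"
        using \<open>y \<notin> S\<close> by (force simp: S_def y)
      with False show ?thesis by (simp add: fl gap_def)
    qed
    then show "measure_pmf.prob (case y of (z, h') \<Rightarrow> run orc (Query (\<lambda>x. z x = s) (\<lambda>v. link A
        (if v - query_mean Q (\<lambda>x. z x = s) \<ge> 2 * \<beta> - \<tau> then succ (\<lambda>x. z x = s) else fl))) h') G \<le> \<delta>"
      by (simp add: y v_def)
  qed
qed

text \<open>The cross entropy bound pays for the updates, each costing
  \<open>3 / 4 * \<beta>\<^sup>2\<close>. A union bound charges \<open>\<gamma>\<close> for each of
  the two possible invocations per round.\<close>

lemma prob_release_fails:
  assumes "cross_entropy D f < real m * (3 / 4 * \<beta>\<^sup>2)"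
  shows "measure_pmf.prob (run orc (link A (release (2 * \<beta> - \<tau>) \<beta> m f)) h)
           {a. \<not> releases \<alpha> D C a} \<le> 2 * real m * \<gamma>"
  using assms
proof (induction m arbitrary: f h)
  case 0
  \<comment> \<open>The assumption would make the cross entropy negative, so the default output is
    never judged.\<close>
  then show ?case
    using cross_entropy_nonneg[of D f] by simp
next
  case (Suc m)
  define G where "G = {a. \<not> releases \<alpha> D C a}"
  define Q where "Q = gibbs f"
  define next_round where
    "next_round = (\<lambda>q. release (2 * \<beta> - \<tau>) \<beta> m (\<lambda>x. f x + \<beta> * of_bool (q x)))"
  define second where
    "second = attempt (2 * \<beta> - \<tau>) Q False next_round (Output (query_mean Q))"
  have next_round: "measure_pmf.prob (run orc (link A (next_round q)) h) G \<le> 2 * real m * \<gamma>"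
    if "query_mean D q - query_mean Q q \<ge> 2 * \<beta> - 2 * \<tau>" for q h
    unfolding next_round_def G_def
  proof (rule Suc.IH)
    \<comment> \<open>From \<open>\<tau> \<le> \<beta> / 8\<close>. The quadratic loss
      \<open>\<beta>\<^sup>2\<close> of the update leaves a net drop of
      \<open>3 / 4 * \<beta>\<^sup>2\<close>.\<close>
    have "7 / 4 * \<beta> \<le> query_mean D q - query_mean Q q"
      using that accuracy by linarith
    then have "\<beta> * (7 / 4 * \<beta>) \<le> \<beta> * (query_mean D q - query_mean Q q)"
      using parameters(1) by (intro mult_left_mono) auto
    moreover have "cross_entropy D (\<lambda>x. f x + \<beta> * of_bool (q x)) \<le>
        cross_entropy D f - \<beta> * (query_mean D q - query_mean Q q) + \<beta>\<^sup>2"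
      unfolding Q_def using parameters by (intro cross_entropy_update) auto
    ultimately show "cross_entropy D (\<lambda>x. f x + \<beta> * of_bool (q x)) < real m * (3 / 4 * \<beta>\<^sup>2)"
      using Suc.prems by (simp add: algebra_simps power2_eq_square)
  qed
  have second: "measure_pmf.prob (run orc (link A second) h) G \<le> \<gamma> + 2 * real m * \<gamma>"
    if pos: "\<forall>c\<in>C. query_mean D (\<lambda>x. c x = True) - query_mean Q (\<lambda>x. c x = True) < \<alpha>" for h
    unfolding second_def
  proof (rule prob_attempt_fails[OF next_round])
    fix h
    assume neg: "\<forall>c\<in>C. query_mean D (\<lambda>x. c x = False) - query_mean Q (\<lambda>x. c x = False) < \<alpha>"
    have "releases \<alpha> D C (query_mean Q)"
      unfolding releases_def
    proof
      fix c assume "c \<in> C"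
      \<comment> \<open>\<open>neg\<close> concerns complements, hence bounds the gap in the
        opposite direction; together the two give the absolute value.\<close>
      with pos neg show "\<bar>query_mean Q c - query_mean D c\<bar> \<le> \<alpha>"
        by (force simp: query_mean_not abs_le_iff)
    qed
    then show "measure_pmf.prob (run orc (link A (Output (query_mean Q))) h) G \<le> 2 * real m * \<gamma>"
      using parameters(4) by (simp add: G_def)
  qed (use parameters(4) in auto)
  have "measure_pmf.prob (run orc (link A (attempt (2 * \<beta> - \<tau>) Q True next_round second)) h) G
      \<le> \<gamma> + (\<gamma> + 2 * real m * \<gamma>)"
  proof (rule prob_attempt_fails[OF _ second])
    \<comment> \<open>Both continuations must share one bound, so the smaller failure probability
      after success is weakened.\<close>
    fix q h assume "query_mean D q - query_mean Q q \<ge> 2 * \<beta> - 2 * \<tau>"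
    from next_round[OF this, of h]
    show "measure_pmf.prob (run orc (link A (next_round q)) h) G \<le> \<gamma> + 2 * real m * \<gamma>"
      using parameters(4) by linarith
  qed (use parameters(4) in auto)
  then show ?case
    by (simp add: G_def Q_def next_round_def second_def Let_def algebra_simps)
qed

end

text \<open>On a one-point universe \<open>T = 0\<close>, so no invocation is allowed; but the only
  distribution is the point mass and the answers are known.\<close>

lemma query_mean_card_1:
  fixes D :: "'a::finite pmf"
  assumes "CARD('a) = 1"
  shows "query_mean D c = of_bool (c undefined)"
proof -
  obtain a :: 'a where UNIV: "UNIV = {a}"
    using assms card_1_singletonE by blast
  then have "x = undefined" for x :: 'a
    by (metis UNIV_I singletonD)
  then have "query_mean D c = query_mean D (\<lambda>_. c undefined)"
    by metis
  then show ?thesis by simp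
qed

theorem theorem5p2:
  fixes C :: "('a::finite \<Rightarrow> bool) set"
    and A :: "'a learner"
    and \<alpha> \<beta> \<gamma> \<tau> T :: real
  assumes "\<alpha> > 0" and "\<beta> > 0" and "\<gamma> > 0" and "\<tau> > 0"
    and "\<tau> \<le> \<beta> / 8"
    and "weak_agnostic_learner (\<alpha> / 2) \<beta> \<gamma> \<tau> C A"
    and "T = 8 * ln (real CARD('a)) / \<beta>\<^sup>2"
  shows "\<exists>B :: ('a, ('a \<Rightarrow> bool) \<Rightarrow> real) invoking_alg.
    (\<forall>(invocations, own_queries) \<in> usage B.
       real invocations \<le> T \<and> own_queries \<le> invocations) \<and>
    (\<forall>D orc. stat_oracle \<tau> D orc \<longrightarrow>
       measure_pmf.prob (run orc (link A B) []) {a. releases \<alpha> D C a} \<ge> 1 - T * \<gamma>)"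
proof (cases "CARD('a) = 1")
  case True
  show ?thesis
  proof (intro exI[of _ "Output (\<lambda>c. of_bool (c undefined))"] conjI allI impI)
    fix D :: "'a pmf" and orc
    show "measure_pmf.prob (run orc (link A (Output (\<lambda>c. of_bool (c undefined)))) [])
        {a. releases \<alpha> D C a} \<ge> 1 - T * \<gamma>"
      using True assms by (simp add: releases_def query_mean_card_1)
  qed (use True assms in auto)
next
  case False
  define L where "L = ln (real CARD('a))"
  \<comment> \<open>The added 1 makes the initial entropy bound strict, as
    \<open>prob_release_fails\<close> demands.\<close>
  define m where "m = nat \<lfloor>4 / 3 * L / \<beta>\<^sup>2\<rfloor> + 1"
  define B where "B = release (2 * \<beta> - \<tau>) \<beta> m (\<lambda>_ :: 'a. 0)"
  have "CARD('a) \<ge> 2"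
    using False zero_less_card_finite[where 'a = 'a] by linarith
  then have "ln 2 \<le> L"
    unfolding L_def by (intro ln_mono) auto
  then have L: "2 / 3 \<le> L"
    using ln2_ge_two_thirds by linarith
  have "\<beta> < 1 / 2"
    using assms(6) by (auto simp: weak_agnostic_learner_def)
  then have \<beta>: "\<beta>\<^sup>2 \<le> 1 / 4"
    using \<open>\<beta> > 0\<close> power_mono[of \<beta> "1 / 2" 2] by (simp add: power2_eq_square)
  have T: "T = 8 * (L / \<beta>\<^sup>2)"
    using assms(7) by (simp add: L_def)
  \<comment> \<open>Doubling \<open>m\<close> turns the added 1 into 2, which must fit into the
    slack \<open>8 - 8 / 3 = 16 / 3\<close> of \<open>T\<close>; here
    \<open>CARD('a) \<ge> 2\<close> and \<open>\<beta> < 1 / 2\<close> enter.\<close>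
  have "2 * \<beta>\<^sup>2 \<le> 16 / 3 * L"
    using L \<beta> by linarith
  then have "2 \<le> 16 / 3 * (L / \<beta>\<^sup>2)"
    using \<open>\<beta> > 0\<close> by (simp add: field_simps)
  moreover have nonneg: "0 \<le> 4 / 3 * L / \<beta>\<^sup>2"
    using L by simp
  then have "real m \<le> 4 / 3 * (L / \<beta>\<^sup>2) + 1"
    unfolding m_def by (simp add: of_nat_floor)
  ultimately have m: "2 * real m \<le> T"
    unfolding T by linarith
  have "4 / 3 * L / \<beta>\<^sup>2 < real m"
    unfolding m_def using nonneg by (simp add: of_nat_nat) linarith
  then have "L < real m * (3 / 4 * \<beta>\<^sup>2)"
    using \<open>\<beta> > 0\<close> by (simp add: field_simps)
  \<comment> \<open>Zero log-weights give the uniform distribution, whose cross entropy is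
    \<open>L\<close> against every \<open>D\<close>.\<close>
  then have entropy: "cross_entropy D (\<lambda>_. 0) < real m * (3 / 4 * \<beta>\<^sup>2)" for D :: "'a pmf"
    by (simp add: cross_entropy_def L_def)
  show ?thesis
  proof (intro exI[of _ B] conjI allI impI)
    show "\<forall>(i, j) \<in> usage B. real i \<le> T \<and> j \<le> i"
    proof (intro ballI, clarify)
      fix i j assume "(i, j) \<in> usage B"
      then have "i \<le> 2 * m" "j \<le> i"
        unfolding B_def by (auto dest: usage_release)
      then have "real i \<le> 2 * real m"
        by linarith
      with m \<open>j \<le> i\<close> show "real i \<le> T \<and> j \<le> i"
        by linarith
    qed
    fix D :: "'a pmf" and orc
    assume "stat_oracle \<tau> D orc"
    from prob_release_fails[OF assms(6,5) this entropy, of "[]"]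
    have "measure_pmf.prob (run orc (link A B) []) {a. \<not> releases \<alpha> D C a} \<le> 2 * real m * \<gamma>"
      unfolding B_def .
    also have "\<dots> \<le> T * \<gamma>"
      using m \<open>\<gamma> > 0\<close> by (intro mult_right_mono) auto
    finally have "measure_pmf.prob (run orc (link A B) []) {a. \<not> releases \<alpha> D C a} \<le> T * \<gamma>" .
    moreover have "{a. \<not> releases \<alpha> D C a} = UNIV - {a. releases \<alpha> D C a}"
      by auto
    ultimately show "measure_pmf.prob (run orc (link A B) []) {a. releases \<alpha> D C a} \<ge> 1 - T * \<gamma>"
      using measure_pmf.prob_compl[of "{a. releases \<alpha> D C a}" "run orc (link A B) []"] by simp
  qed
qed

end
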